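(* Let $G$ be a simple graph with $n$ vertices, $m$ edges and first Zagreb index $Z_1 = Z_1(G)$, and let $\alpha \in [0,1]$. Then $$\lambda_1(A_\alpha(G)) \le \frac{2\alpha m + \sqrt{(n-1)\left(\alpha^2\left(-4m^2 + 2mn + nZ_1\right) - 4\alpha m n + 2mn\right)}}{n}.$$ If $G$ is isomorphic to the complete graph $K_n$, equality holds.
   Context: For a simple graph $G$ with adjacency matrix $A(G)$ and diagonal degree matrix $D(G)$, and $\alpha\in[0,1]$, define $A_\alpha(G) = \alpha D(G) + (1-\alpha)A(G)$, with eigenvalues ordered $\lambda_1(A_\alpha(G)) \ge \dots \ge \lambda_n(A_\alpha(G))$. The first Zagreb index is $Z_1(G) = \sum_{i=1}^n d(v_i)^2$, where $d(v_i)$ is the degree of vertex $v_i$. *)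

theory Defs
  imports Complex_Main "Jordan_Normal_Form.Char_Poly"
begin

record 'a graph =
  verts :: "'a set"
  edges :: "'a set set"

definition simple_graph :: "'a graph \<Rightarrow> bool" where
  "simple_graph G \<longleftrightarrow> finite (verts G) \<and> edges G \<subseteq> {e. e \<subseteq> verts G \<and> card e = 2}"

definition vdegree :: "'a graph \<Rightarrow> 'a \<Rightarrow> nat" where
  "vdegree G v = card {e \<in> edges G. v \<in> e}"

definition first_zagreb :: "'a graph \<Rightarrow> nat" where
  "first_zagreb G = (\<Sum>v\<in>verts G. (vdegree G v)\<^sup>2)"

definition complete_graph :: "nat \<Rightarrow> nat graph" where
  "complete_graph n = \<lparr>verts = {..<n}, edges = {e. e \<subseteq> {..<n} \<and> card e = 2}\<rparr>"

definition graph_isomorphic :: "'a graph \<Rightarrow> 'b graph \<Rightarrow> bool" where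
  "graph_isomorphic G H \<longleftrightarrow>
     (\<exists>f. bij_betw f (verts G) (verts H) \<and>
          (\<forall>u\<in>verts G. \<forall>v\<in>verts G. {u, v} \<in> edges G \<longleftrightarrow> {f u, f v} \<in> edges H))"

text \<open>The list \<open>vs\<close> is the enumeration \<open>v\<^sub>1, \<dots>, v\<^sub>n\<close> of the vertices that indexes rows and
  columns. In a simple graph the diagonal of the adjacency matrix is zero, because
  \<open>{v, v} = {v}\<close> has one element and is not an edge.\<close>

definition vertex_enum :: "'a graph \<Rightarrow> 'a list \<Rightarrow> bool" where
  "vertex_enum G vs \<longleftrightarrow> distinct vs \<and> set vs = verts G"

definition adj_mat :: "'a graph \<Rightarrow> 'a list \<Rightarrow> real mat" where
  "adj_mat G vs = mat (length vs) (length vs)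
     (\<lambda>(i, j). if {vs ! i, vs ! j} \<in> edges G then 1 else 0)"

definition deg_mat :: "'a graph \<Rightarrow> 'a list \<Rightarrow> real mat" where
  "deg_mat G vs = mat_diag (length vs) (\<lambda>i. real (vdegree G (vs ! i)))"

definition A_alpha :: "real \<Rightarrow> 'a graph \<Rightarrow> 'a list \<Rightarrow> real mat" where
  "A_alpha \<alpha> G vs = \<alpha> \<cdot>\<^sub>m deg_mat G vs + (1 - \<alpha>) \<cdot>\<^sub>m adj_mat G vs"

text \<open>\<open>eigval k A\<close> is the \<open>k\<close>-th largest eigenvalue (counting from 1, with multiplicity).
  Only real roots of the characteristic polynomial are listed, which for the symmetric
  matrices considered here are all of them.\<close>

definition eigval :: "nat \<Rightarrow> real mat \<Rightarrow> real" where
  "eigval k A = rev (sorted_list_of_multiset (proots (char_poly A))) ! (k - 1)"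

end

theory Submission
  imports Defs "HOL-Analysis.Convex"
begin

text \<open>
  Let \<open>k\<close> be an eigenvalue of a real \<open>n \<times> n\<close> matrix \<open>A\<close> with unit eigenvector \<open>x\<close>, and write \<open>t\<close>
  for the trace of \<open>A\<close> and \<open>s\<close> for its squared Frobenius norm. The Cauchy--Schwarz inequality for
  the Frobenius inner product of \<open>A - k x x\<^sup>T\<close> and \<open>I - x x\<^sup>T\<close> reads
  \<open>(t - k)\<^sup>2 \<le> (n - 1) (s - k\<^sup>2)\<close>, which is a quadratic inequality in \<open>k\<close>; no spectral
  decomposition is needed. For \<open>A\<^sub>\<alpha>(G)\<close> one has \<open>t = 2 \<alpha> m\<close> and
  \<open>s = \<alpha>\<^sup>2 Z\<^sub>1 + 2 (1 - \<alpha>)\<^sup>2 m\<close>. For \<open>K\<^sub>n\<close> the bound is \<open>n - 1\<close>, which is the eigenvalue of the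
  all-ones vector.
\<close>

section \<open>The trace-Frobenius bound on a real eigenvalue\<close>

lemma trace_frobenius_unit_eigenvector:
  fixes a :: "nat \<Rightarrow> nat \<Rightarrow> real" and x :: "nat \<Rightarrow> real"
  assumes eig: "\<And>i. i < n \<Longrightarrow> (\<Sum>j<n. a i j * x j) = k * x i"
    and unit: "(\<Sum>i<n. (x i)\<^sup>2) = 1"
  shows "((\<Sum>i<n. a i i) - k)\<^sup>2 \<le> (real n - 1) * ((\<Sum>i<n. \<Sum>j<n. (a i j)\<^sup>2) - k\<^sup>2)"
proof -
  define \<delta> :: "nat \<Rightarrow> nat \<Rightarrow> real" where "\<delta> i j = (if i = j then 1 else 0)" for i j
  define B where "B i j = a i j - k * (x i * x j)" for i j
  define P where "P i j = \<delta> i j - x i * x j" for i j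
  have diag: "(\<Sum>i<n. \<Sum>j<n. \<delta> i j * f i j) = (\<Sum>i<n. f i i)" for f
    by (intro sum.cong) (simp_all add: \<delta>_def if_distrib[of "\<lambda>c. c * _"] cong: if_cong)
  have axx: "(\<Sum>i<n. \<Sum>j<n. a i j * (x i * x j)) = k"
  proof -
    have "(\<Sum>i<n. \<Sum>j<n. a i j * (x i * x j)) = (\<Sum>i<n. x i * (\<Sum>j<n. a i j * x j))"
      by (simp add: sum_distrib_left mult_ac)
    also have "\<dots> = (\<Sum>i<n. k * (x i)\<^sup>2)"
      by (intro sum.cong) (simp_all add: eig power2_eq_square)
    finally show ?thesis
      by (simp add: unit flip: sum_distrib_left)
  qed
  have xx: "(\<Sum>i<n. \<Sum>j<n. (x i * x j)\<^sup>2) = 1"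
    by (simp add: power_mult_distrib unit flip: sum_distrib_left)
  have dxx: "(\<Sum>i<n. \<Sum>j<n. \<delta> i j * (x i * x j)) = 1"
    by (simp add: diag unit flip: power2_eq_square)
  have BP: "(\<Sum>i<n. \<Sum>j<n. B i j * P i j) = (\<Sum>i<n. a i i) - k"
  proof -
    \<comment> \<open>Summed over all pairs, the four terms give the trace, \<open>- k\<close>,
      \<open>- k\<close> and \<open>+ k\<close>.\<close>
    have "B i j * P i j = \<delta> i j * a i j - a i j * (x i * x j) - k * (\<delta> i j * (x i * x j))
        + k * (x i * x j)\<^sup>2" for i j
      by (simp add: B_def P_def algebra_simps power2_eq_square)
    then show ?thesis
      by (simp only: sum.distrib sum_subtractf diag[of a] axx xx dxx flip: sum_distrib_left)
  qed
  have BB: "(\<Sum>i<n. \<Sum>j<n. (B i j)\<^sup>2) = (\<Sum>i<n. \<Sum>j<n. (a i j)\<^sup>2) - k\<^sup>2"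
  proof -
    have "(B i j)\<^sup>2 = (a i j)\<^sup>2 - 2 * k * (a i j * (x i * x j)) + k\<^sup>2 * (x i * x j)\<^sup>2" for i j
      by (simp add: B_def algebra_simps power2_eq_square)
    then show ?thesis
      by (simp only: sum.distrib sum_subtractf axx xx flip: sum_distrib_left)
         (simp add: power2_eq_square)
  qed
  have PP: "(\<Sum>i<n. \<Sum>j<n. (P i j)\<^sup>2) = real n - 1"
  proof -
    \<comment> \<open>Since \<delta> is 0/1-valued, its square is itself; the three sums are
      \<open>n\<close>, \<open>- 2\<close> and \<open>1\<close>.\<close>
    have "(P i j)\<^sup>2 = \<delta> i j * 1 - 2 * (\<delta> i j * (x i * x j)) + (x i * x j)\<^sup>2" for i j
      by (simp add: P_def \<delta>_def algebra_simps power2_eq_square)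
    then show ?thesis
      by (simp only: sum.distrib sum_subtractf diag[of "\<lambda>_ _. 1"] xx dxx flip: sum_distrib_left) simp
  qed
  let ?I = "{..<n} \<times> {..<n}"
  have "(\<Sum>p\<in>?I. case_prod B p * case_prod P p)\<^sup>2
      \<le> (\<Sum>p\<in>?I. (case_prod B p)\<^sup>2) * (\<Sum>p\<in>?I. (case_prod P p)\<^sup>2)"
    by (rule Cauchy_Schwarz_ineq_sum)
  then have "(\<Sum>i<n. \<Sum>j<n. B i j * P i j)\<^sup>2
      \<le> (\<Sum>i<n. \<Sum>j<n. (B i j)\<^sup>2) * (\<Sum>i<n. \<Sum>j<n. (P i j)\<^sup>2)"
    by (simp add: sum.cartesian_product case_prod_unfold)
  then show ?thesis
    by (simp add: BP BB PP mult.commute)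
qed

lemma mult_mat_vec_index:
  assumes "A \<in> carrier_mat n n" "v \<in> carrier_vec n" "i < n"
  shows "(A *\<^sub>v v) $ i = (\<Sum>j<n. A $$ (i, j) * v $ j)"
  using assms by (auto simp: scalar_prod_def lessThan_atLeast0 intro!: sum.cong)

text \<open>Multiplying \<open>(t - k)\<^sup>2 \<le> (n - 1) (s - k\<^sup>2)\<close> by
  \<open>n\<close> and completing the square in \<open>k\<close> gives
  \<open>(n k - t)\<^sup>2 \<le> (n - 1) (n s - t\<^sup>2)\<close>; a square root then isolates
  \<open>k\<close>.\<close>

lemma eigenvalue_le_trace_frobenius:
  fixes A :: "real mat"
  assumes A: "A \<in> carrier_mat n n" and ev: "eigenvalue A k"
    and t: "t = (\<Sum>i<n. A $$ (i, i))" and s: "s = (\<Sum>i<n. \<Sum>j<n. (A $$ (i, j))\<^sup>2)"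
  shows "k \<le> (t + sqrt ((real n - 1) * (real n * s - t\<^sup>2))) / real n"
proof -
  obtain v where v: "v \<in> carrier_vec n" "v \<noteq> 0\<^sub>v n" "A *\<^sub>v v = k \<cdot>\<^sub>v v"
    using ev A unfolding eigenvalue_def eigenvector_def by auto
  obtain l where l: "l < n" "v $ l \<noteq> 0"
    using v(1,2) by (metis carrier_vecD eq_vecI index_zero_vec)
  define q where "q = (\<Sum>i<n. (v $ i)\<^sup>2)"
  have q: "q > 0"
    unfolding q_def using l by (intro sum_pos2[of _ l]) auto
  define x where "x i = v $ i / sqrt q" for i
  have "(\<Sum>i<n. (x i)\<^sup>2) = 1"
    using q by (simp add: x_def power_divide q_def[symmetric] flip: sum_divide_distrib)
  moreover have "(\<Sum>j<n. A $$ (i, j) * x j) = k * x i" if "i < n" for i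
    using mult_mat_vec_index[OF A v(1) that] v that
    by (simp add: x_def flip: sum_divide_distrib)
  ultimately have "(t - k)\<^sup>2 \<le> (real n - 1) * (s - k\<^sup>2)"
    unfolding t s by (intro trace_frobenius_unit_eigenvector)
  then have "real n * (t - k)\<^sup>2 \<le> real n * ((real n - 1) * (s - k\<^sup>2))"
    by (intro mult_left_mono) auto
  then have "(real n * k - t)\<^sup>2 \<le> (real n - 1) * (real n * s - t\<^sup>2)"
    by (simp add: algebra_simps power2_eq_square)
  then have "real n * k - t \<le> sqrt ((real n - 1) * (real n * s - t\<^sup>2))"
    by (rule real_le_rsqrt)
  then show ?thesis
    using l by (simp add: field_simps)
qed

section \<open>The largest eigenvalue is well defined\<close>

text \<open>This guarantees that the list inside \<open>eigval\<close> is nonempty, so that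
  \<open>eigval 1\<close> is not an out-of-range list access. The characteristic polynomial has a
  complex root, and the Hermitian form of a real symmetric matrix forces that root to be
  real.\<close>

lemma symmetric_real_mat_has_eigenvalue:
  fixes A :: "real mat"
  assumes A: "A \<in> carrier_mat n n" and n: "n > 0"
    and sym: "\<And>i j. i < n \<Longrightarrow> j < n \<Longrightarrow> A $$ (i, j) = A $$ (j, i)"
  shows "\<exists>k. eigenvalue A k"
proof -
  let ?C = "map_mat complex_of_real A"
  have C: "?C \<in> carrier_mat n n" using A by simp
  have cp: "char_poly ?C = map_poly complex_of_real (char_poly A)"
    by (rule of_real_hom.char_poly_hom[OF A])
  have "degree (char_poly ?C) > 0"
    using degree_monic_char_poly[OF C] n by simp
  then have "\<not> constant (poly (char_poly ?C))"
    by (simp add: constant_degree)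
  then obtain z where z: "poly (char_poly ?C) z = 0"
    using fundamental_theorem_of_algebra by blast
  then have "eigenvalue ?C z"
    by (simp add: eigenvalue_root_char_poly[OF C])
  then obtain v where v: "v \<in> carrier_vec n" "v \<noteq> 0\<^sub>v n" "?C *\<^sub>v v = z \<cdot>\<^sub>v v"
    using C unfolding eigenvalue_def eigenvector_def by auto
  obtain l where l: "l < n" "v $ l \<noteq> 0"
    using v(1,2) by (metis carrier_vecD eq_vecI index_zero_vec)
  define q where "q = (\<Sum>i<n. (cmod (v $ i))\<^sup>2)"
  have q: "q > 0"
    unfolding q_def using l by (intro sum_pos2[of _ l]) auto
  \<comment> \<open>The Hermitian form \<open>v* A v\<close>, evaluated in two ways: the eigenvector
    equation gives \<open>z * q\<close>, and symmetry shows that it equals its own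
    conjugate.\<close>
  define w where "w = (\<Sum>i<n. \<Sum>j<n. complex_of_real (A $$ (i, j)) * (cnj (v $ i) * v $ j))"
  have "w = (\<Sum>i<n. cnj (v $ i) * (\<Sum>j<n. ?C $$ (i, j) * v $ j))"
    using A unfolding w_def by (auto simp: sum_distrib_left mult_ac intro!: sum.cong)
  also have "\<dots> = (\<Sum>i<n. cnj (v $ i) * (z * v $ i))"
    using v by (intro sum.cong) (simp_all flip: mult_mat_vec_index[OF C v(1)])
  also have "\<dots> = z * complex_of_real q"
    by (simp add: q_def sum_distrib_left complex_norm_square mult_ac del: of_real_power)
  finally have w: "w = z * complex_of_real q" .
  have "cnj w = (\<Sum>i<n. \<Sum>j<n. complex_of_real (A $$ (j, i)) * (cnj (v $ j) * v $ i))"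
    unfolding w_def by (simp add: sym mult_ac)
  also have "\<dots> = w"
    unfolding w_def by (rule sum.swap)
  finally have "cnj z = z"
    using q by (simp add: w)
  then have "z = complex_of_real (Re z)"
    by (simp add: complex_eq_iff)
  then have "poly (char_poly A) (Re z) = 0"
    using z unfolding cp by (metis of_real_eq_0_iff of_real_hom.poly_map_poly)
  then show ?thesis
    by (auto simp: eigenvalue_root_char_poly[OF A])
qed

lemma eigval_1_greatest:
  fixes A :: "real mat"
  assumes A: "A \<in> carrier_mat n n" and ev: "eigenvalue A k"
  shows "eigenvalue A (eigval 1 A)" and "k \<le> eigval 1 A"
proof -
  define L where "L = sorted_list_of_multiset (proots (char_poly A))"
  have "char_poly A \<noteq> 0"
    using degree_monic_char_poly[OF A] by auto
  then have set: "set L = Collect (eigenvalue A)"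
    by (auto simp: L_def eigenvalue_root_char_poly[OF A])
  have ne: "L \<noteq> []" using set ev by auto
  \<comment> \<open>For \<open>k = 1\<close> the index \<open>k - 1\<close> is 0, the head of the
    reversed ascending list.\<close>
  have last: "eigval 1 A = last L"
    using ne by (simp add: eigval_def L_def[symmetric] rev_nth last_conv_nth)
  show "eigenvalue A (eigval 1 A)"
    using last_in_set[OF ne] unfolding last set by simp
  obtain i where "i < length L" "k = L ! i"
    using ev set by (metis in_set_conv_nth mem_Collect_eq)
  moreover have "sorted L" by (simp add: L_def)
  ultimately show "k \<le> eigval 1 A"
    unfolding last last_conv_nth[OF ne] by (auto intro: sorted_nth_mono)
qed

section \<open>Degrees and the handshake identity\<close>

text \<open>The map from \<open>u\<close> to \<open>{v, u}\<close> is a bijection from neighbours to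
  incident edges. This links the edge-based degree to row sums of the adjacency matrix.\<close>

lemma vdegree_eq_card_neighbours:
  assumes G: "simple_graph G"
  shows "vdegree G v = card {u \<in> verts G. {v, u} \<in> edges G}"
proof -
  have inj: "inj_on (\<lambda>u. {v, u}) {u \<in> verts G. {v, u} \<in> edges G}"
    by (auto simp: inj_on_def doubleton_eq_iff)
  have "(\<lambda>u. {v, u}) ` {u \<in> verts G. {v, u} \<in> edges G} = {e \<in> edges G. v \<in> e}"
  proof (intro equalityI subsetI)
    fix e assume e: "e \<in> {e \<in> edges G. v \<in> e}"
    then have "e \<subseteq> verts G" "card e = 2"
      using G by (auto simp: simple_graph_def)
    with e obtain u where "e = {v, u}" "u \<in> verts G"
      by (auto simp: card_2_iff)
    with e show "e \<in> (\<lambda>u. {v, u}) ` {u \<in> verts G. {v, u} \<in> edges G}" by auto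
  qed auto
  then show ?thesis
    unfolding vdegree_def using card_image[OF inj] by simp
qed

text \<open>Double counting of incident vertex-edge pairs: each edge contains exactly two
  vertices.\<close>

lemma sum_vdegree:
  assumes G: "simple_graph G"
  shows "(\<Sum>v\<in>verts G. vdegree G v) = 2 * card (edges G)"
proof -
  have V: "finite (verts G)" using G by (simp add: simple_graph_def)
  have "edges G \<subseteq> Pow (verts G)" using G by (auto simp: simple_graph_def)
  with V have E: "finite (edges G)" by (simp add: finite_subset)
  have "(\<Sum>v\<in>verts G. vdegree G v) = (\<Sum>v\<in>verts G. \<Sum>e\<in>edges G. if v \<in> e then 1 else 0)"
    using E by (simp add: vdegree_def sum.If_cases Int_def)
  also have "\<dots> = (\<Sum>e\<in>edges G. \<Sum>v\<in>verts G. if v \<in> e then 1 else 0)"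
    by (rule sum.swap)
  also have "\<dots> = (\<Sum>e\<in>edges G. 2)"
  proof (intro sum.cong refl)
    fix e assume "e \<in> edges G"
    then have "verts G \<inter> e = e" "card e = 2" using G by (auto simp: simple_graph_def)
    then show "(\<Sum>v\<in>verts G. if v \<in> e then 1 else 0) = (2::nat)"
      using V by (simp add: sum.If_cases)
  qed
  finally show ?thesis by simp
qed

section \<open>Row sums, trace and Frobenius norm of \<open>A_alpha\<close>\<close>

lemma A_alpha_carrier: "A_alpha \<alpha> G vs \<in> carrier_mat (length vs) (length vs)"
  by (simp add: A_alpha_def deg_mat_def adj_mat_def mat_diag_def)

lemma A_alpha_index:
  assumes "i < length vs" "j < length vs"
  shows "A_alpha \<alpha> G vs $$ (i, j) =
    (if i = j then \<alpha> * real (vdegree G (vs ! i)) else 0)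
    + (1 - \<alpha>) * (if {vs ! i, vs ! j} \<in> edges G then 1 else 0)"
  using assms by (simp add: A_alpha_def deg_mat_def adj_mat_def mat_diag_def)

lemma sum_vertex_enum:
  assumes "vertex_enum G vs"
  shows "(\<Sum>i<length vs. f (vs ! i)) = (\<Sum>v\<in>verts G. f v)"
proof (rule sum.reindex_bij_betw)
  show "bij_betw ((!) vs) {..<length vs} (verts G)"
    using assms by (auto simp: vertex_enum_def intro!: bij_betw_nth)
qed

lemma no_loop: "simple_graph G \<Longrightarrow> {v} \<notin> edges G"
  by (auto simp: simple_graph_def)

lemma adj_row_sum:
  assumes G: "simple_graph G" and vs: "vertex_enum G vs"
  shows "(\<Sum>j<length vs. if {v, vs ! j} \<in> edges G then 1 else 0 :: real) = real (vdegree G v)"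
proof -
  have "finite (verts G)" using G by (simp add: simple_graph_def)
  then show ?thesis
    unfolding sum_vertex_enum[OF vs, of "\<lambda>u. if {v, u} \<in> edges G then 1 else 0"]
    by (simp add: vdegree_eq_card_neighbours[OF G] sum.If_cases Int_def)
qed

text \<open>The two parts contribute \<alpha> \<open>d\<close> and \<open>(1 - \<alpha>) d\<close>,
  so \<alpha> cancels.\<close>

lemma A_alpha_row_sum:
  assumes G: "simple_graph G" and vs: "vertex_enum G vs" and i: "i < length vs"
  shows "(\<Sum>j<length vs. A_alpha \<alpha> G vs $$ (i, j)) = real (vdegree G (vs ! i))"
  using i by (simp add: A_alpha_index sum.distrib adj_row_sum[OF G vs] flip: sum_distrib_left)
    (simp add: algebra_simps)

lemma A_alpha_trace:
  assumes G: "simple_graph G" and vs: "vertex_enum G vs"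
  shows "(\<Sum>i<length vs. A_alpha \<alpha> G vs $$ (i, i)) = 2 * \<alpha> * real (card (edges G))"
proof -
  have "(\<Sum>i<length vs. A_alpha \<alpha> G vs $$ (i, i)) = (\<Sum>i<length vs. \<alpha> * real (vdegree G (vs ! i)))"
    by (simp add: A_alpha_index no_loop[OF G])
  also have "\<dots> = \<alpha> * real (\<Sum>v\<in>verts G. vdegree G v)"
    by (simp add: sum_vertex_enum[OF vs, of "\<lambda>v. real (vdegree G v)"] flip: sum_distrib_left)
  finally show ?thesis by (simp add: sum_vdegree[OF G])
qed

lemma A_alpha_frobenius:
  assumes G: "simple_graph G" and vs: "vertex_enum G vs"
  shows "(\<Sum>i<length vs. \<Sum>j<length vs. (A_alpha \<alpha> G vs $$ (i, j))\<^sup>2) =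
    \<alpha>\<^sup>2 * real (first_zagreb G) + (1 - \<alpha>)\<^sup>2 * (2 * real (card (edges G)))"
proof -
  let ?d = "\<lambda>v. real (vdegree G v)"
  have row: "(\<Sum>j<length vs. (A_alpha \<alpha> G vs $$ (i, j))\<^sup>2)
      = \<alpha>\<^sup>2 * (?d (vs ! i))\<^sup>2 + (1 - \<alpha>)\<^sup>2 * ?d (vs ! i)" if "i < length vs" for i
  proof -
    \<comment> \<open>The cross term vanishes: the degree part lives on the diagonal, where the
      adjacency part is zero because there are no loops.\<close>
    have "(A_alpha \<alpha> G vs $$ (i, j))\<^sup>2 = (if i = j then \<alpha>\<^sup>2 * (?d (vs ! i))\<^sup>2 else 0)
        + (1 - \<alpha>)\<^sup>2 * (if {vs ! i, vs ! j} \<in> edges G then 1 else 0)" if "j < length vs" for j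
      using \<open>i < length vs\<close> that
      by (auto simp: A_alpha_index no_loop[OF G] power_mult_distrib)
    then show ?thesis
      using that by (simp add: sum.distrib adj_row_sum[OF G vs] flip: sum_distrib_left)
  qed
  have "(\<Sum>i<length vs. \<Sum>j<length vs. (A_alpha \<alpha> G vs $$ (i, j))\<^sup>2)
      = \<alpha>\<^sup>2 * (\<Sum>v\<in>verts G. (?d v)\<^sup>2) + (1 - \<alpha>)\<^sup>2 * (\<Sum>v\<in>verts G. ?d v)"
    by (simp add: row sum.distrib sum_vertex_enum[OF vs, of ?d]
        sum_vertex_enum[OF vs, of "\<lambda>v. (?d v)\<^sup>2"] flip: sum_distrib_left)
  also have "(\<Sum>v\<in>verts G. ?d v) = 2 * real (card (edges G))"
    using arg_cong[OF sum_vdegree[OF G], of real] by simp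
  finally show ?thesis by (simp add: first_zagreb_def)
qed

section \<open>Complete and regular graphs\<close>

lemma complete_graph_vdegree:
  assumes G: "simple_graph G" and iso: "graph_isomorphic G (complete_graph n)"
    and v: "v \<in> verts G"
  shows "vdegree G v = card (verts G) - 1"
proof -
  obtain f where f: "bij_betw f (verts G) {..<n}"
    and E: "\<And>u v. u \<in> verts G \<Longrightarrow> v \<in> verts G \<Longrightarrow>
      {u, v} \<in> edges G \<longleftrightarrow> {f u, f v} \<subseteq> {..<n} \<and> card {f u, f v} = 2"
    using iso by (auto simp: graph_isomorphic_def complete_graph_def)
  have "{v, u} \<in> edges G \<longleftrightarrow> u \<noteq> v" if "u \<in> verts G" for u
  proof -
    have "f v = f u \<longleftrightarrow> v = u" "f v \<in> {..<n}" "f u \<in> {..<n}"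
      using f v that by (auto simp: bij_betw_def inj_on_def)
    then show ?thesis
      by (auto simp: E[OF v that] card_insert_if)
  qed
  then have "{u \<in> verts G. {v, u} \<in> edges G} = verts G - {v}" by auto
  then show ?thesis
    using v by (simp add: vdegree_eq_card_neighbours[OF G])
qed

text \<open>All row sums equal \<open>d\<close>, so the all-ones vector is an eigenvector, whatever
  \<alpha> is.\<close>

lemma regular_graph_eigenvalue:
  assumes G: "simple_graph G" and vs: "vertex_enum G vs" and ne: "verts G \<noteq> {}"
    and reg: "\<And>v. v \<in> verts G \<Longrightarrow> vdegree G v = d"
  shows "eigenvalue (A_alpha \<alpha> G vs) (real d)"
proof -
  let ?A = "A_alpha \<alpha> G vs" and ?n = "length vs"
  define w where "w = vec ?n (\<lambda>_. 1 :: real)"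
  have w: "w \<in> carrier_vec ?n" by (simp add: w_def)
  have n: "0 < ?n" using vs ne by (auto simp: vertex_enum_def)
  have "?A *\<^sub>v w = real d \<cdot>\<^sub>v w"
  proof (rule eq_vecI)
    fix i assume "i < dim_vec (real d \<cdot>\<^sub>v w)"
    then have i: "i < ?n" by (simp add: w_def)
    then have "vs ! i \<in> verts G" using vs nth_mem[OF i] by (simp add: vertex_enum_def)
    then show "(?A *\<^sub>v w) $ i = (real d \<cdot>\<^sub>v w) $ i"
      using i A_alpha_row_sum[OF G vs i, of \<alpha>]
      by (simp add: mult_mat_vec_index[OF A_alpha_carrier w i] reg)
         (simp add: w_def)
  qed (use A_alpha_carrier[of \<alpha> G vs] in \<open>simp add: w_def\<close>)
  moreover have "w \<noteq> 0\<^sub>v ?n"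
    using n by (metis index_vec index_zero_vec(1) w_def zero_neq_one)
  ultimately show ?thesis
    using w A_alpha_carrier[of \<alpha> G vs] unfolding eigenvalue_def eigenvector_def by auto
qed

section \<open>The bound and its equality case\<close>

theorem theorem3p4:
  fixes G :: "'a graph" and vs :: "'a list" and n m Z1 :: nat and \<alpha> :: real
  assumes "simple_graph G" and "verts G \<noteq> {}" and "vertex_enum G vs"
    and "n = card (verts G)" and "m = card (edges G)" and "Z1 = first_zagreb G"
    and "0 \<le> \<alpha>" and "\<alpha> \<le> 1"
  shows "eigval 1 (A_alpha \<alpha> G vs) \<le>
           (2 * \<alpha> * real m +
              sqrt ((real n - 1) *
                (\<alpha>\<^sup>2 * (- 4 * (real m)\<^sup>2 + 2 * real m * real n + real n * real Z1)
                  - 4 * \<alpha> * real m * real n + 2 * real m * real n))) / real n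
       \<and> (graph_isomorphic G (complete_graph n) \<longrightarrow>
          eigval 1 (A_alpha \<alpha> G vs) =
           (2 * \<alpha> * real m +
              sqrt ((real n - 1) *
                (\<alpha>\<^sup>2 * (- 4 * (real m)\<^sup>2 + 2 * real m * real n + real n * real Z1)
                  - 4 * \<alpha> * real m * real n + 2 * real m * real n))) / real n)"
proof -
  let ?A = "A_alpha \<alpha> G vs"
  define R where "R = (2 * \<alpha> * real m +
      sqrt ((real n - 1) *
        (\<alpha>\<^sup>2 * (- 4 * (real m)\<^sup>2 + 2 * real m * real n + real n * real Z1)
          - 4 * \<alpha> * real m * real n + 2 * real m * real n))) / real n"
  note G = assms(1) and vs = assms(3) and m = assms(5) and Z1 = assms(6)
  have len: "length vs = n"
    using vs assms(4) by (simp add: vertex_enum_def flip: distinct_card)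
  have n: "n > 0"
    using assms by (simp add: simple_graph_def card_gt_0_iff)
  have A: "?A \<in> carrier_mat n n"
    using A_alpha_carrier[of \<alpha> G vs] by (simp add: len)
  have "\<exists>k. eigenvalue ?A k"
    by (rule symmetric_real_mat_has_eigenvalue[OF A n])
       (simp add: A_alpha_index len insert_commute)
  then have ev: "eigenvalue ?A (eigval 1 ?A)"
    using eigval_1_greatest(1)[OF A] by blast
  have "eigval 1 ?A \<le> (2 * \<alpha> * real m + sqrt ((real n - 1) *
      (real n * (\<alpha>\<^sup>2 * real Z1 + (1 - \<alpha>)\<^sup>2 * (2 * real m)) - (2 * \<alpha> * real m)\<^sup>2))) / real n"
    using eigenvalue_le_trace_frobenius[OF A ev refl refl]
      A_alpha_trace[OF G vs, of \<alpha>] A_alpha_frobenius[OF G vs, of \<alpha>]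
    by (simp only: len m Z1)
  \<comment> \<open>Expanding \<open>(1 - \<alpha>)\<^sup>2\<close> turns
    \<open>n s - t\<^sup>2\<close> into the stated radicand.\<close>
  also have "\<dots> = R"
    unfolding R_def by (simp add: algebra_simps power2_eq_square)
  finally have le: "eigval 1 ?A \<le> R" .
  have eq: "eigval 1 ?A = R" if iso: "graph_isomorphic G (complete_graph n)"
  proof -
    have reg: "vdegree G v = n - 1" if "v \<in> verts G" for v
      using complete_graph_vdegree[OF G iso that] assms(4) by simp
    have r: "real (n - 1) = real n - 1" using n by simp
    \<comment> \<open>The handshake identity for an \<open>(n - 1)\<close>-regular graph.\<close>
    have "real (2 * m) = real n * (real n - 1)"
      unfolding m sum_vdegree[OF G, symmetric] using reg assms(4) r by simp
    then have m': "real m = real n * (real n - 1) / 2" by simp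
    have Z': "real Z1 = real n * (real n - 1)\<^sup>2"
      unfolding Z1 first_zagreb_def using reg assms(4) r by simp
    \<comment> \<open>After substituting \<open>m\<close> and \<open>Z1\<close>, the terms
      \<open>n\<^sup>2 (n - 1)\<^sup>2\<close> cancel, leaving
      \<open>n\<^sup>2 (n - 1) (1 - \<alpha>)\<^sup>2\<close> as second factor, so the radicand is a
      perfect square. Its root has no absolute value because \<alpha> \<le> 1.\<close>
    have "(real n - 1) *
        (\<alpha>\<^sup>2 * (- 4 * (real m)\<^sup>2 + 2 * real m * real n + real n * real Z1)
          - 4 * \<alpha> * real m * real n + 2 * real m * real n)
        = ((1 - \<alpha>) * (real n * (real n - 1)))\<^sup>2"
      unfolding m' Z' by (simp add: field_simps power2_eq_square)
    then have "R = (2 * \<alpha> * real m + (1 - \<alpha>) * (real n * (real n - 1))) / real n"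
      using n assms(8) by (simp add: R_def)
    also have "\<dots> = real (n - 1)"
      unfolding m' r using n by (simp add: field_simps)
    \<comment> \<open>Here \<open>n - 1\<close> is an eigenvalue by regularity, hence at most the
      largest one; \<open>le\<close> supplies the opposite inequality.\<close>
    also have "\<dots> \<le> eigval 1 ?A"
      by (rule eigval_1_greatest(2)[OF A regular_graph_eigenvalue[OF G vs assms(2) reg]])
    finally show ?thesis using le by simp
  qed
  show ?thesis
    using le eq unfolding R_def by blast
qed

end
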